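(* Let $(H,\phi)$ be a solution of the EdGB system on its maximal interval of existence $(\mathcal T_-,\mathcal T_+)\ni 0$. Then the following identity holds for all $t\in(\mathcal T_-,\mathcal T_+)$: $$\mathcal P:=H\left(\left(1-H^2e^\phi+\frac{\dot H}{3H^2}\right)\dot\phi^2+4H^3\dot\phi e^\phi+3H^6e^{2\phi}\left(1+\frac{\dot H}{H^2}\right)\right)=0.$$
   Context: Dots denote derivatives with respect to $t$. The EdGB system (Einstein-dilaton-Gauss-Bonnet equations with exponential coupling $e^\phi$ for a spatially flat FLRW metric with Hubble parameter $H$ and scalar field $\phi$), for real-valued functions $H,\phi$ of $t$ with $H,\phi,\dot\phi\in C^1$, is $$3H^2-3e^\phi\dot\phi H^3=\tfrac{\dot\phi^2}{2},\qquad 2\dot H+3H^2=-\tfrac{\dot\phi^2}{2}+2e^\phi\dot\phi H(H^2+\dot H)+e^\phi H^2(\dot\phi^2+\ddot\phi),\qquad \ddot\phi=-3H\dot\phi-3e^\phi H^2(H^2+\dot H).$$ Initial data are prescribed at $t=0$. $\mathcal T_-\in[-\infty,0)$ and $\mathcal T_+\in(0,+\infty]$ are the maximal backward and forward existence times of the solution. *)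

theory Defs
  imports "HOL-Analysis.Analysis"
begin

definition edgb_solution_on :: "real set \<Rightarrow> (real \<Rightarrow> real) \<Rightarrow> (real \<Rightarrow> real) \<Rightarrow> bool"
  where "edgb_solution_on I H \<phi> \<longleftrightarrow>
    H C1_differentiable_on I \<and> \<phi> C1_differentiable_on I \<and> deriv \<phi> C1_differentiable_on I \<and>
    (\<forall>t\<in>I.
      3 * (H t)^2 - 3 * exp (\<phi> t) * deriv \<phi> t * (H t)^3 = (deriv \<phi> t)^2 / 2 \<and>
      2 * deriv H t + 3 * (H t)^2
        = - ((deriv \<phi> t)^2 / 2)
          + 2 * exp (\<phi> t) * deriv \<phi> t * H t * ((H t)^2 + deriv H t)
          + exp (\<phi> t) * (H t)^2 * ((deriv \<phi> t)^2 + deriv (deriv \<phi>) t) \<and>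
      deriv (deriv \<phi>) t
        = - 3 * H t * deriv \<phi> t - 3 * exp (\<phi> t) * (H t)^2 * ((H t)^2 + deriv H t))"

text \<open>
  The functions are total on the reals, but only their values on the interval
  \<open>einterval a b\<close> matter. The initial data at time 0 are the values there of \<open>H\<close>,
  \<open>\<phi>\<close> and \<open>deriv \<phi>\<close>. Maximality means that the solution cannot be continued, as a
  solution of the same regularity, beyond either of the endpoints.

  \<open>H\<close> is allowed to vanish: the equations then force \<open>deriv \<phi>\<close> and \<open>deriv H\<close> to vanish at
  that time as well, and expressions such as \<open>H * (deriv H / H^2)\<close> are read with \<open>x / 0 = 0\<close>.
\<close>

definition edgb_maximal_solution ::
    "ereal \<Rightarrow> ereal \<Rightarrow> (real \<Rightarrow> real) \<Rightarrow> (real \<Rightarrow> real) \<Rightarrow> bool"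
  where "edgb_maximal_solution a b H \<phi> \<longleftrightarrow>
    a < 0 \<and> 0 < b \<and> edgb_solution_on (einterval a b) H \<phi> \<and>
    (\<forall>a' b' H' \<phi>'.
      a' \<le> a \<longrightarrow> b \<le> b' \<longrightarrow> edgb_solution_on (einterval a' b') H' \<phi>' \<longrightarrow>
      (\<forall>t\<in>einterval a b. H' t = H t \<and> \<phi>' t = \<phi> t) \<longrightarrow> a' = a \<and> b' = b)"

end

theory Submission
  imports Defs
begin

text \<open>
  Where \<open>H\<close> vanishes the identity is trivial. Elsewhere it is purely algebraic: using the third
  equation to eliminate the second derivative of \<open>\<phi>\<close> from the second one determines
  \<open>3 e^{2\<phi>} H^4 (H^2 + H')\<close>, and the first equation, multiplied by \<open>1 + 2 H' / (3 H^2)\<close>,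
  cancels all that remains.
\<close>

text \<open>The variables \<open>F\<close>, \<open>p\<close>, \<open>q\<close>, \<open>D\<close> stand for \<open>e^\<phi>\<close>, \<open>\<phi>'\<close>, \<open>\<phi>''\<close>, \<open>H'\<close>.\<close>

lemma edgb_algebraic_identity:
  fixes H F p q D :: real
  assumes "H \<noteq> 0"
    and constraint: "3 * H^2 - 3 * F * p * H^3 = p^2 / 2"
    and evolution: "2 * D + 3 * H^2
      = - (p^2 / 2) + 2 * F * p * H * (H^2 + D) + F * H^2 * (p^2 + q)"
    and scalar: "q = - 3 * H * p - 3 * F * H^2 * (H^2 + D)"
  shows "(1 - H^2 * F + D / (3 * H^2)) * p^2 + 4 * H^3 * p * F
    + 3 * H^6 * F^2 * (1 + D / H^2) = 0"
proof -
  have p2: "p^2 = 6 * H^2 - 6 * F * p * H^3"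
    using constraint by simp
  \<comment> \<open>By the constraint \<open>p^2\<close> is a multiple of \<open>H^2\<close>, which
    clears the denominator.\<close>
  have "D / (3 * H^2) * p^2 = 2 * D - 2 * F * p * H * D"
    unfolding p2 using \<open>H \<noteq> 0\<close> by (simp add: field_simps eval_nat_numeral)
  moreover have "3 * H^6 * F^2 * (1 + D / H^2) = 3 * F^2 * H^4 * (H^2 + D)"
    using \<open>H \<noteq> 0\<close> by (simp add: field_simps eval_nat_numeral)
  moreover have "3 * F^2 * H^4 * (H^2 + D)
      = - (p^2 / 2) + 2 * F * p * H * D - F * p * H^3 + F * H^2 * p^2 - 2 * D - 3 * H^2"
    using evolution unfolding scalar by (simp add: algebra_simps eval_nat_numeral)
  \<comment> \<open>In the sum all terms with \<open>D\<close> or \<open>F * H^2 * p^2\<close>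
    cancel; the rest, \<open>p^2 / 2 + 3 * F * p * H^3 - 3 * H^2\<close>, is zero by the
    constraint.\<close>
  ultimately show ?thesis
    using constraint by (simp add: algebra_simps)
qed

theorem lemma3p2:
  fixes H \<phi> :: "real \<Rightarrow> real" and T_minus T_plus :: ereal
  assumes "edgb_maximal_solution T_minus T_plus H \<phi>"
  shows "\<forall>t\<in>einterval T_minus T_plus.
    H t * ((1 - (H t)^2 * exp (\<phi> t) + deriv H t / (3 * (H t)^2)) * (deriv \<phi> t)^2
      + 4 * (H t)^3 * deriv \<phi> t * exp (\<phi> t)
      + 3 * (H t)^6 * exp (2 * \<phi> t) * (1 + deriv H t / (H t)^2)) = 0"
proof
  fix t
  assume t: "t \<in> einterval T_minus T_plus"
  have sol: "edgb_solution_on (einterval T_minus T_plus) H \<phi>"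
    using assms by (simp add: edgb_maximal_solution_def)
  show "H t * ((1 - (H t)^2 * exp (\<phi> t) + deriv H t / (3 * (H t)^2)) * (deriv \<phi> t)^2
      + 4 * (H t)^3 * deriv \<phi> t * exp (\<phi> t)
      + 3 * (H t)^6 * exp (2 * \<phi> t) * (1 + deriv H t / (H t)^2)) = 0"
  proof (cases "H t = 0")
    case False
    have "exp (2 * \<phi> t) = (exp (\<phi> t))^2"
      by (rule exp_double)
    moreover have "(1 - (H t)^2 * exp (\<phi> t) + deriv H t / (3 * (H t)^2)) * (deriv \<phi> t)^2
      + 4 * (H t)^3 * deriv \<phi> t * exp (\<phi> t)
      + 3 * (H t)^6 * (exp (\<phi> t))^2 * (1 + deriv H t / (H t)^2) = 0"
      using False sol t
      \<comment> \<open>The conclusion of the algebraic identity does not contain \<open>q\<close>,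
        so unification cannot find it.\<close>
      by (intro edgb_algebraic_identity[where q = "deriv (deriv \<phi>) t"])
        (unfold edgb_solution_on_def, blast+)
    ultimately show ?thesis
      by (simp only: mult_zero_right)
  qed simp
qed

end
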